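(* Let $G=(U,V,E)$ be a bipartite (multi)graph with $|U|=|V|=n$ in which every edge is colored red or blue. The linear system in $x\in\mathbb{R}^E$ $\sum_{e\in\delta(w)}x_e=1$ for all $w\in U\cup V$; $\sum_{e\in E_L}x_e\ge 1$ for all $L\in\mathcal{L}_{\mathrm{all}}(G)$; $x_e\ge0$ for all $e\in E$, is feasible if and only if $G$ has a perfect matching with an odd number of red edges.
   Context: An edge is written $(u,v,c)$ with $u\in U$, $v\in V$, color $c\in\{\text{red},\text{blue}\}$; $\delta(w)$ is the set of edges incident to $w$. $\mathcal{L}_{\mathrm{all}}(G)$ is the set of labelings $L:U\cup V\to\{0,1\}$ with $|L^{-1}(1)|\equiv n\pmod 2$, and for such $L$, $E_L:=\{(u,v,c)\in E: L(u)=L(v),\ c=\text{blue}\}\cup\{(u,v,c)\in E: L(u)\ne L(v),\ c=\text{red}\}$. *)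

theory Defs
  imports Complex_Main "HOL-Library.FuncSet" "HOL-Number_Theory.Cong"
begin

datatype colour = Red | Blue

text \<open>
  A multigraph has an abstract edge set. The edge written \<open>(u, v, c)\<close> is an \<open>e\<close> whose end in the
  left class is \<open>u\<close>, whose end in the right class is \<open>v\<close> and whose colour is \<open>c\<close>; several edges,
  also of the same colour, may share both ends.
\<close>

record ('a, 'e) rb_graph =
  left :: "'a set"
  right :: "'a set"
  edges :: "'e set"
  lend :: "'e \<Rightarrow> 'a"
  rend :: "'e \<Rightarrow> 'a"
  col :: "'e \<Rightarrow> colour"

definition bipartite_multigraph :: "('a, 'e) rb_graph \<Rightarrow> bool" where
  "bipartite_multigraph G \<longleftrightarrow>
     finite (left G) \<and> finite (right G) \<and> finite (edges G) \<and> left G \<inter> right G = {} \<and>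
     (\<forall>e\<in>edges G. lend G e \<in> left G \<and> rend G e \<in> right G)"

definition verts :: "('a, 'e) rb_graph \<Rightarrow> 'a set" where
  "verts G = left G \<union> right G"

definition incident_edges :: "('a, 'e) rb_graph \<Rightarrow> 'a \<Rightarrow> 'e set" where
  "incident_edges G w = {e \<in> edges G. lend G e = w \<or> rend G e = w}"

definition perfect_matching :: "('a, 'e) rb_graph \<Rightarrow> 'e set \<Rightarrow> bool" where
  "perfect_matching G M \<longleftrightarrow>
     M \<subseteq> edges G \<and> (\<forall>w\<in>verts G. \<exists>!e. e \<in> M \<and> e \<in> incident_edges G w)"

definition red_edges :: "('a, 'e) rb_graph \<Rightarrow> 'e set" where
  "red_edges G = {e \<in> edges G. col G e = Red}"

definition all_labelings :: "('a, 'e) rb_graph \<Rightarrow> nat \<Rightarrow> ('a \<Rightarrow> nat) set" where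
  "all_labelings G n =
     {L \<in> verts G \<rightarrow>\<^sub>E {0, 1}. [card {w \<in> verts G. L w = 1} = n] (mod 2)}"

definition label_edges :: "('a, 'e) rb_graph \<Rightarrow> ('a \<Rightarrow> nat) \<Rightarrow> 'e set" where
  "label_edges G L =
     {e \<in> edges G. L (lend G e) = L (rend G e) \<and> col G e = Blue} \<union>
     {e \<in> edges G. L (lend G e) \<noteq> L (rend G e) \<and> col G e = Red}"

definition feasible_region :: "('a, 'e) rb_graph \<Rightarrow> nat \<Rightarrow> ('e \<Rightarrow> real) set" where
  "feasible_region G n =
     {x \<in> edges G \<rightarrow>\<^sub>E UNIV.
        (\<forall>w\<in>verts G. (\<Sum>e\<in>incident_edges G w. x e) = 1) \<and>
        (\<forall>L\<in>all_labelings G n. (\<Sum>e\<in>label_edges G L. x e) \<ge> 1) \<and>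
        (\<forall>e\<in>edges G. x e \<ge> 0)}"

end

theory Submission
  imports Defs
begin

text \<open>For a perfect matching \<open>M\<close> and a labeling \<open>L\<close> the number of ones of \<open>L\<close>, the number of red
  edges of \<open>M\<close>, \<open>n\<close> and \<open>\<bar>M \<inter> E\<^sub>L\<bar>\<close> have an even sum, so an odd perfect matching meets every \<open>E\<^sub>L\<close>.
  Conversely, let \<open>x\<close> be feasible with support \<open>F\<close> and suppose that all perfect matchings are even.
  By Hall's theorem every edge of \<open>F\<close> lies in a perfect matching inside \<open>F\<close>. Hence an integer vector
  on \<open>F\<close> whose degrees all vanish is a difference of two sums of perfect matchings and so has
  even weight on the red edges. In particular every cycle in \<open>F\<close> has evenly many red edges, and being
  of even length also evenly many blue ones; the parity of blue edges along walks is then a labeling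
  \<open>L\<close> for which \<open>E\<^sub>L\<close> misses \<open>F\<close>, and it violates its constraint.\<close>

section \<open>Hall's marriage theorem\<close>

text \<open>Induction on \<open>U\<close>. If some nonempty proper subset \<open>J\<close> is tight,
  \<open>J\<close> and \<open>U - J\<close> are matched separately, the latter avoiding the
  neighbours of \<open>J\<close>. Otherwise every such subset has a spare neighbour, so any
  \<open>u\<close> may take any \<open>v\<close> in \<open>A u\<close>.\<close>

lemma hall_marriage:
  fixes A :: "'a \<Rightarrow> 'b set"
  assumes "finite U" and "\<And>u. u \<in> U \<Longrightarrow> finite (A u)"
    and "\<And>J. J \<subseteq> U \<Longrightarrow> card J \<le> card (\<Union>(A ` J))"
  shows "\<exists>f. inj_on f U \<and> (\<forall>u\<in>U. f u \<in> A u)"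
  using assms
proof (induction U arbitrary: A rule: finite_psubset_induct)
  case (psubset U)
  note IH = psubset.IH and finA = psubset.prems(1) and hall = psubset.prems(2)
  have finJ: "finite (\<Union>(A ` J))" if "J \<subseteq> U" for J
    using that finA psubset.hyps by (auto intro: finite_subset)
  show ?case
  proof (cases "\<exists>J. J \<subset> U \<and> J \<noteq> {} \<and> card (\<Union>(A ` J)) = card J")
    case True
    then obtain J where J: "J \<subset> U" "card (\<Union>(A ` J)) = card J" "J \<noteq> {}" by blast
    have "\<exists>f. inj_on f J \<and> (\<forall>u\<in>J. f u \<in> A u)"
      proof (rule IH[OF J(1)])
      fix K assume "K \<subseteq> J" then show "card K \<le> card (\<Union>(A ` K))" using J(1) by (intro hall) auto
    qed (use J(1) finA in auto)
    then obtain f where f: "inj_on f J" "\<And>u. u \<in> J \<Longrightarrow> f u \<in> A u" by blast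
    define B where "B = (\<lambda>u. A u - \<Union>(A ` J))"
    have "\<exists>g. inj_on g (U - J) \<and> (\<forall>u\<in>U - J. g u \<in> B u)"
    proof (rule IH)
      show "U - J \<subset> U" using J by blast
    next
      fix u assume "u \<in> U - J" then show "finite (B u)" using finA by (auto simp: B_def)
    next
      fix K assume K: "K \<subseteq> U - J"
      \<comment> \<open>Tightness of \<open>J\<close> passes the condition on: \<open>J\<close> and
        \<open>K\<close> together have enough neighbours, and only \<open>card J\<close> of them are
        used up by \<open>J\<close>.\<close>
      have "card J + card K = card (J \<union> K)"
        using K J(1) psubset.hyps by (intro card_Un_disjoint[symmetric]) (auto intro: finite_subset)
      also have "\<dots> \<le> card (\<Union>(A ` (J \<union> K)))" using K J(1) by (intro hall) auto
      also have "\<Union>(A ` (J \<union> K)) = \<Union>(A ` J) \<union> \<Union>(B ` K)" by (auto simp: B_def)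
      also have "card \<dots> \<le> card J + card (\<Union>(B ` K))" using card_Un_le J(2) by metis
      finally show "card K \<le> card (\<Union>(B ` K))" by simp
    qed
    then obtain g where g: "inj_on g (U - J)" "\<And>u. u \<in> U - J \<Longrightarrow> g u \<in> B u" by blast
    have "inj_on (\<lambda>u. if u \<in> J then f u else g u) U"
      using f g unfolding inj_on_def B_def by (smt (verit) Diff_iff UN_I)
    moreover have "\<forall>u\<in>U. (if u \<in> J then f u else g u) \<in> A u" using f g by (auto simp: B_def)
    ultimately show ?thesis by blast
  next
    case False
    show ?thesis
    proof (cases "U = {}")
      case ne: False
      then obtain u where u: "u \<in> U" by blast
      then have "A u \<noteq> {}" using hall[of "{u}"] by auto
      then obtain v where v: "v \<in> A u" by blast
      define B where "B = (\<lambda>w. A w - {v})"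
      have "\<exists>g. inj_on g (U - {u}) \<and> (\<forall>w\<in>U - {u}. g w \<in> B w)"
      proof (rule IH)
        fix K assume K: "K \<subseteq> U - {u}"
        show "card K \<le> card (\<Union>(B ` K))"
        proof (cases "K = {}")
          case ne: False
          \<comment> \<open>\<open>K\<close> is a proper subset since it omits \<open>u\<close>, so
            it is not tight; its surplus pays for the loss of \<open>v\<close>.\<close>
          have "card K \<noteq> card (\<Union>(A ` K))" using K False u ne by (metis Diff_iff psubsetI subset_Diff_insert subset_iff)
          moreover have "card K \<le> card (\<Union>(A ` K))" using K by (intro hall) auto
          moreover have "\<Union>(B ` K) = \<Union>(A ` K) - {v}" by (auto simp: B_def)
          moreover have "card (\<Union>(A ` K)) - 1 \<le> card (\<Union>(A ` K) - {v})"
            by (simp add: card_Diff_singleton_if)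
          ultimately show ?thesis by simp
        qed simp
      qed (use u finA in \<open>auto simp: B_def\<close>)
      then obtain g where g: "inj_on g (U - {u})" "\<And>w. w \<in> U - {u} \<Longrightarrow> g w \<in> B w" by blast
      have "inj_on (g(u := v)) U"
        using g unfolding inj_on_def B_def by auto
      moreover have "\<forall>w\<in>U. (g(u := v)) w \<in> A w" using g v by (auto simp: B_def)
      ultimately show ?thesis by blast
    qed simp
  qed
qed

section \<open>Degree sums and perfect matchings in a balanced bipartite multigraph\<close>

locale balanced_graph =
  fixes G :: "('a, 'e) rb_graph"
  assumes bipartite: "bipartite_multigraph G"
    and balanced: "card (left G) = card (right G)"
begin

abbreviation "wdeg x w \<equiv> sum x (incident_edges G w)"

lemma finite_simps [simp]: "finite (left G)" "finite (right G)" "finite (verts G)" "finite (edges G)"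
  "finite (incident_edges G w)" "finite (red_edges G)" "finite (label_edges G L)"
  using bipartite
  by (auto simp: bipartite_multigraph_def verts_def incident_edges_def red_edges_def label_edges_def)

lemma ends: "e \<in> edges G \<Longrightarrow> lend G e \<in> left G" "e \<in> edges G \<Longrightarrow> rend G e \<in> right G"
  "left G \<inter> right G = {}"
  using bipartite by (auto simp: bipartite_multigraph_def)

lemma incident_left: "u \<in> left G \<Longrightarrow> incident_edges G u = {e \<in> edges G. lend G e = u}"
  and incident_right: "v \<in> right G \<Longrightarrow> incident_edges G v = {e \<in> edges G. rend G e = v}"
  using ends by (auto simp: incident_edges_def)

lemma sum_wdeg_left:
  fixes x :: "'e \<Rightarrow> 'b::comm_monoid_add"
  assumes "J \<subseteq> left G"
  shows "(\<Sum>u\<in>J. wdeg x u) = sum x {e \<in> edges G. lend G e \<in> J}"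
proof -
  have "(\<Sum>u\<in>J. wdeg x u) = (\<Sum>u\<in>J. sum x {e \<in> {e \<in> edges G. lend G e \<in> J}. lend G e = u})"
    using assms by (intro sum.cong) (auto simp: incident_left intro!: arg_cong[of _ _ "sum x"])
  also have "\<dots> = sum x {e \<in> edges G. lend G e \<in> J}"
    using assms by (intro sum.group) (auto intro: finite_subset)
  finally show ?thesis .
qed

lemma sum_wdeg_right:
  fixes x :: "'e \<Rightarrow> 'b::comm_monoid_add"
  assumes "J \<subseteq> right G"
  shows "(\<Sum>u\<in>J. wdeg x u) = sum x {e \<in> edges G. rend G e \<in> J}"
proof -
  have "(\<Sum>u\<in>J. wdeg x u) = (\<Sum>u\<in>J. sum x {e \<in> {e \<in> edges G. rend G e \<in> J}. rend G e = u})"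
    using assms by (intro sum.cong) (auto simp: incident_right intro!: arg_cong[of _ _ "sum x"])
  also have "\<dots> = sum x {e \<in> edges G. rend G e \<in> J}"
    using assms by (intro sum.group) (auto intro: finite_subset)
  finally show ?thesis .
qed

lemma wdeg_matching:
  assumes "perfect_matching G M" "w \<in> verts G"
  shows "wdeg (\<lambda>e. of_bool (e \<in> M)) w = (1 :: 'b::semiring_1)"
proof -
  have "\<exists>!e. e \<in> M \<and> e \<in> incident_edges G w"
    using assms by (simp add: perfect_matching_def)
  then obtain e where "incident_edges G w \<inter> M = {e}" by (elim ex1E) blast
  then show ?thesis by (simp add: of_bool_def sum.If_cases)
qed

lemma bij_betw_matching:
  assumes "perfect_matching G M"
  shows "bij_betw (lend G) M (left G)" "bij_betw (rend G) M (right G)"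
proof -
  have M: "M \<subseteq> edges G" and ex: "\<And>w. w \<in> verts G \<Longrightarrow> \<exists>!e. e \<in> M \<and> e \<in> incident_edges G w"
    using assms by (auto simp: perfect_matching_def)
  show "bij_betw (lend G) M (left G)"
    unfolding bij_betw_def
  proof (intro conjI inj_onI equalityI subsetI)
    fix e f assume "e \<in> M" "f \<in> M" "lend G e = lend G f"
    then show "e = f" using ex[of "lend G e"] M ends(1) by (auto simp: incident_edges_def verts_def subset_iff)
  next
    fix u assume "u \<in> left G"
    then show "u \<in> lend G ` M" using ex[of u] by (auto simp: incident_left verts_def)
  qed (use M ends in auto)
  show "bij_betw (rend G) M (right G)"
    unfolding bij_betw_def
  proof (intro conjI inj_onI equalityI subsetI)
    fix e f assume "e \<in> M" "f \<in> M" "rend G e = rend G f"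
    then show "e = f" using ex[of "rend G e"] M ends(2) by (auto simp: incident_edges_def verts_def subset_iff)
  next
    fix u assume "u \<in> right G"
    then show "u \<in> rend G ` M" using ex[of u] by (auto simp: incident_right verts_def)
  qed (use M ends in auto)
qed

section \<open>Perfect matchings in the support of a regular weighting\<close>

text \<open>Hall's condition follows by counting weight: the weight \<open>card J * c\<close> at
  \<open>J\<close> all runs to the neighbours \<open>?N\<close> of \<open>J\<close> in the support,
  and these carry only \<open>card ?N * c\<close>. The field is arbitrary so that both real and
  rational weights are covered.\<close>

lemma perfect_matching_in_support:
  fixes x :: "'e \<Rightarrow> 'b::linordered_field"
  assumes nonneg: "\<And>e. e \<in> edges G \<Longrightarrow> 0 \<le> x e"
    and deg: "\<And>w. w \<in> verts G \<Longrightarrow> wdeg x w = c" and "0 < c"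
  shows "\<exists>M. perfect_matching G M \<and> (\<forall>e\<in>M. 0 < x e)"
proof -
  define A where "A = (\<lambda>u. rend G ` {e \<in> edges G. lend G e = u \<and> 0 < x e})"
  have "\<exists>f. inj_on f (left G) \<and> (\<forall>u\<in>left G. f u \<in> A u)"
  proof (rule hall_marriage)
    fix J assume J: "J \<subseteq> left G"
    let ?N = "\<Union>(A ` J)"
    have N: "?N \<subseteq> right G" using ends by (auto simp: A_def)
    have "of_nat (card J) * c = sum x {e \<in> edges G. lend G e \<in> J}"
      using J deg by (subst sum_wdeg_left[symmetric]) (auto simp: verts_def subset_iff)
    also have "\<dots> = sum x {e \<in> edges G. lend G e \<in> J \<and> 0 < x e}"
      using nonneg by (intro sum.mono_neutral_right) (auto simp: order_le_less)
    also have "\<dots> \<le> sum x {e \<in> edges G. rend G e \<in> ?N}"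
      using nonneg by (intro sum_mono2) (auto simp: A_def)
    also have "\<dots> = of_nat (card ?N) * c"
      using N deg by (subst sum_wdeg_right[symmetric]) (auto simp: verts_def subset_iff)
    finally show "card J \<le> card ?N" using \<open>0 < c\<close> by simp
  qed (auto simp: A_def)
  then obtain f where f: "inj_on f (left G)" "\<And>u. u \<in> left G \<Longrightarrow> f u \<in> A u" by blast
  have "f ` left G \<subseteq> right G" using f(2) ends by (fastforce simp: A_def)
  then have f_onto: "f ` left G = right G"
    using f(1) balanced by (intro card_subset_eq) (auto simp: card_image)
  \<comment> \<open>Hall's theorem only pairs vertices; \<open>h\<close> selects one of the possibly
    parallel edges of positive weight for each pair.\<close>
  have "\<forall>u\<in>left G. \<exists>e. e \<in> edges G \<and> lend G e = u \<and> rend G e = f u \<and> 0 < x e"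
    using f(2) by (fastforce simp: A_def)
  then obtain h where h: "\<And>u. u \<in> left G \<Longrightarrow>
      h u \<in> edges G \<and> lend G (h u) = u \<and> rend G (h u) = f u \<and> 0 < x (h u)"
    by metis
  have "perfect_matching G (h ` left G)"
    unfolding perfect_matching_def
  proof (intro conjI ballI)
    fix w assume "w \<in> verts G"
    then consider "w \<in> left G" | "w \<in> right G" by (auto simp: verts_def)
    then show "\<exists>!e. e \<in> h ` left G \<and> e \<in> incident_edges G w"
    proof cases
      case 1
      then show ?thesis using h by (intro ex1I[of _ "h w"]) (auto simp: incident_left)
    next
      case 2
      then obtain u where "u \<in> left G" "w = f u" using f_onto by auto
      then show ?thesis using h 2 f(1) by (intro ex1I[of _ "h u"]) (auto simp: incident_right inj_on_def)
    qed
  qed (use h in auto)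
  then show ?thesis using h by blast
qed

text \<open>As long as the matching found in the support misses \<open>e0\<close>, a multiple of it
  is subtracted. The result is still regular, \<open>e0\<close> keeps its weight, and the support
  shrinks.\<close>

lemma perfect_matching_through_edge:
  fixes x :: "'e \<Rightarrow> 'b::linordered_field"
  assumes "\<And>e. e \<in> edges G \<Longrightarrow> 0 \<le> x e"
    and "\<And>w. w \<in> verts G \<Longrightarrow> wdeg x w = c" and e0: "e0 \<in> edges G" "0 < x e0"
  shows "\<exists>M. perfect_matching G M \<and> (\<forall>e\<in>M. 0 < x e) \<and> e0 \<in> M"
  using assms
proof (induction "card {e \<in> edges G. 0 < x e}" arbitrary: x c rule: less_induct)
  case less
  note nonneg = less.prems(1) and deg = less.prems(2)
  have "0 < x e0" by (rule less.prems)
  also have "x e0 \<le> wdeg x (lend G e0)"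
    using nonneg e0 by (intro member_le_sum) (auto simp: incident_edges_def)
  also have "\<dots> = c" using deg e0 ends by (auto simp: verts_def)
  finally obtain M where M: "perfect_matching G M" "\<And>e. e \<in> M \<Longrightarrow> 0 < x e"
    using perfect_matching_in_support[of x c] nonneg deg by blast
  have ME: "M \<subseteq> edges G" and "M \<noteq> {}"
    using M(1) e0 ends(1) by (auto simp: perfect_matching_def verts_def)
  then have finM: "finite M" by (auto intro: finite_subset)
  show ?case
  proof (cases "e0 \<in> M")
    case False
    \<comment> \<open>The least weight on \<open>M\<close> is the largest multiple that keeps the
      weights nonnegative, and it removes \<open>e1\<close> from the support.\<close>
    define t where "t = Min (x ` M)"
    have "t \<in> x ` M" unfolding t_def using finM \<open>M \<noteq> {}\<close> by (intro Min_in) auto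
    then obtain e1 where e1: "e1 \<in> M" "t = x e1" by blast
    have t: "t \<le> x e" if "e \<in> M" for e using that finM by (auto simp: t_def)
    have "0 < t" using e1 M by auto
    define y where "y = (\<lambda>e. x e - t * of_bool (e \<in> M))"
    have "y e \<le> x e" for e using \<open>0 < t\<close> by (auto simp: y_def)
    then have pos: "0 < x e" if "0 < y e" for e using that by (meson less_le_trans)
    have "\<exists>M. perfect_matching G M \<and> (\<forall>e\<in>M. 0 < y e) \<and> e0 \<in> M"
    proof (rule less.hyps)
      have "e1 \<in> {e \<in> edges G. 0 < x e} - {e \<in> edges G. 0 < y e}"
        using e1 ME M by (auto simp: y_def)
      then show "card {e \<in> edges G. 0 < y e} < card {e \<in> edges G. 0 < x e}"
        using pos by (intro psubset_card_mono) auto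
    next
      fix e assume "e \<in> edges G" then show "0 \<le> y e" using nonneg t by (auto simp: y_def)
    next
      fix w assume "w \<in> verts G"
      then show "wdeg y w = c - t"
        using deg wdeg_matching[OF M(1), where 'b = 'b] by (simp add: y_def sum_subtractf flip: sum_distrib_left)
    qed (use False less.prems in \<open>auto simp: y_def\<close>)
    then show ?thesis using pos by blast
  qed (use M in blast)
qed

section \<open>Parity of the red weight of integer vectors\<close>

text \<open>A nonnegative integer vector of constant degree \<open>k\<close> is a sum of
  \<open>k\<close> perfect matchings from its support; they are peeled off one at a time, and each
  has evenly many red edges.\<close>

lemma even_red_sum_regular:
  fixes y :: "'e \<Rightarrow> int"
  assumes "\<And>e. e \<in> edges G \<Longrightarrow> 0 \<le> y e" and "\<And>w. w \<in> verts G \<Longrightarrow> wdeg y w = int k"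
    and "\<And>M. perfect_matching G M \<Longrightarrow> \<forall>e\<in>M. 0 < y e \<Longrightarrow> even (card (M \<inter> red_edges G))"
  shows "even (sum y (red_edges G))"
  using assms
proof (induction k arbitrary: y)
  case 0
  have "y e = 0" if "e \<in> edges G" for e
  proof -
    have "wdeg y (lend G e) = 0" using 0(2) that ends by (auto simp: verts_def)
    then show ?thesis using that 0(1) by (subst (asm) sum_nonneg_eq_0_iff) (auto simp: incident_edges_def)
  qed
  then show ?case by (simp add: red_edges_def)
next
  case (Suc k)
  note nonneg = Suc.prems(1) and deg = Suc.prems(2)
  \<comment> \<open>The weights move to the rationals because the matching lemma is stated over a
    field. Integrality returns below: positive weights are at least 1, so subtracting
    \<open>M\<close> keeps them nonnegative.\<close>
  have "\<exists>M. perfect_matching G M \<and> (\<forall>e\<in>M. 0 < (of_int (y e) :: rat))"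
    using nonneg deg by (intro perfect_matching_in_support[where c = "of_nat (Suc k)"])
      (auto simp flip: of_int_sum)
  then obtain M where M: "perfect_matching G M" "\<And>e. e \<in> M \<Longrightarrow> 0 < y e" by auto
  define y' where "y' = (\<lambda>e. y e - of_bool (e \<in> M))"
  have "even (sum y' (red_edges G))"
  proof (rule Suc.IH)
    fix e assume "e \<in> edges G" then show "0 \<le> y' e"
      using nonneg M(2)[of e] by (auto simp: y'_def of_bool_def)
  next
    fix w assume "w \<in> verts G" then show "wdeg y' w = int k"
      using deg wdeg_matching[OF M(1), where 'b = int] by (simp add: y'_def sum_subtractf)
  next
    fix N assume "perfect_matching G N" "\<forall>e\<in>N. 0 < y' e"
    then show "even (card (N \<inter> red_edges G))"
      by (intro Suc.prems(3)) (fastforce simp: y'_def of_bool_def split: if_splits)+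
  qed
  moreover have "sum y' (red_edges G) = sum y (red_edges G) - int (card (M \<inter> red_edges G))"
    by (simp add: y'_def sum_subtractf of_bool_def sum.If_cases Int_commute)
  ultimately show ?case using Suc.prems(3)[OF M(1)] M(2) by auto
qed

text \<open>Adding to \<open>z\<close> a sum \<open>y\<close> of perfect matchings that dominates \<open>\<bar>z\<bar>\<close> yields a nonnegative
  regular vector, which splits into perfect matchings just as \<open>y\<close> does.\<close>

lemma even_red_sum_circulation:
  fixes z :: "'e \<Rightarrow> int"
  assumes cover: "\<And>e. e \<in> F \<Longrightarrow> \<exists>M. perfect_matching G M \<and> M \<subseteq> F \<and> e \<in> M"
    and even: "\<And>M. perfect_matching G M \<Longrightarrow> M \<subseteq> F \<Longrightarrow> even (card (M \<inter> red_edges G))"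
    and supp: "\<And>e. e \<notin> F \<Longrightarrow> z e = 0" and deg: "\<And>w. w \<in> verts G \<Longrightarrow> wdeg z w = 0"
  shows "even (sum z (red_edges G))"
proof -
  have FE: "F \<subseteq> edges G" using cover by (meson perfect_matching_def subset_iff)
  then have "finite F" by (auto intro: finite_subset)
  obtain m where m: "\<And>e. e \<in> F \<Longrightarrow> perfect_matching G (m e) \<and> m e \<subseteq> F \<and> e \<in> m e"
    using cover by metis
  \<comment> \<open>Every \<open>f\<close> contributes \<open>abs (z f)\<close> copies of a matching
    through \<open>f\<close> itself, which gives the domination; \<open>k\<close> is the number of
    matchings used.\<close>
  define y where "y = (\<lambda>e. \<Sum>f\<in>F. \<bar>z f\<bar> * of_bool (e \<in> m f))"
  define k where "k = nat (\<Sum>f\<in>F. \<bar>z f\<bar>)"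
  have y_nonneg: "0 \<le> y e" for e by (auto simp: y_def intro!: sum_nonneg)
  have y_ge: "\<bar>z e\<bar> \<le> y e" for e
  proof (cases "e \<in> F")
    case True
    then have "\<bar>z e\<bar> = \<bar>z e\<bar> * of_bool (e \<in> m e)" using m by simp
    also have "\<dots> \<le> y e"
      using True \<open>finite F\<close> unfolding y_def by (intro member_le_sum) auto
    finally show ?thesis .
  qed (use supp y_nonneg in auto)
  have y_supp: "y e = 0" if "e \<notin> F" for e
    using that m unfolding y_def by (intro sum.neutral) (auto simp: subset_iff)
  have y_deg: "wdeg y w = int k" if "w \<in> verts G" for w
  proof -
    have "wdeg y w = (\<Sum>f\<in>F. \<bar>z f\<bar> * wdeg (\<lambda>e. of_bool (e \<in> m f)) w)"
      unfolding y_def by (subst sum.swap) (simp only: sum_distrib_left)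
    also have "\<dots> = (\<Sum>f\<in>F. \<bar>z f\<bar>)"
      using wdeg_matching[OF _ that, where 'b = int] m by (intro sum.cong) auto
    finally show ?thesis by (simp add: k_def sum_nonneg)
  qed
  have "even (sum y (red_edges G))"
    using y_nonneg y_deg
  proof (rule even_red_sum_regular)
    fix M assume "perfect_matching G M" "\<forall>e\<in>M. 0 < y e"
    then show "even (card (M \<inter> red_edges G))" using y_supp by (intro even) force+
  qed
  moreover have "even (sum (\<lambda>e. y e + z e) (red_edges G))"
  proof (rule even_red_sum_regular)
    fix e show "0 \<le> y e + z e" using y_ge[of e] by linarith
  next
    fix w assume "w \<in> verts G" then show "wdeg (\<lambda>e. y e + z e) w = int k"
      using y_deg deg by (simp add: sum.distrib)
  next
    fix M assume "perfect_matching G M" "\<forall>e\<in>M. 0 < y e + z e"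
    then show "even (card (M \<inter> red_edges G))" using y_supp supp by (intro even) force+
  qed
  ultimately show ?thesis by (simp add: sum.distrib)
qed

section \<open>Labelings and parity\<close>

text \<open>All four terms are sums over \<open>M\<close>, because \<open>M\<close> pairs up the
  vertices. Each edge contributes its two end labels, 1, and the indicators of being red and of
  lying in \<open>label_edges G L\<close>; for either colour this is even.\<close>

lemma label_parity:
  assumes M: "perfect_matching G M" and L: "\<And>w. w \<in> verts G \<Longrightarrow> L w \<in> {0, 1::nat}"
  shows "even (card {w \<in> verts G. L w = 1} + card (M \<inter> red_edges G) + card (left G)
    + card (M \<inter> label_edges G L))"
proof -
  have ME: "M \<subseteq> edges G" using M by (auto simp: perfect_matching_def)
  then have finM: "finite M" by (auto intro: finite_subset)
  have "card {w \<in> verts G. L w = 1} = (\<Sum>w\<in>verts G. of_bool (L w = 1))"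
    by (simp add: of_bool_def sum.If_cases Int_def)
  also have "\<dots> = sum L (verts G)" using L by (intro sum.cong) force+
  also have "\<dots> = sum L (left G) + sum L (right G)"
    unfolding verts_def using ends by (intro sum.union_disjoint) auto
  also have "\<dots> = (\<Sum>e\<in>M. L (lend G e) + L (rend G e))"
    using bij_betw_matching[OF M] by (simp add: sum.distrib sum.reindex_bij_betw)
  finally have "card {w \<in> verts G. L w = 1} = \<dots>" .
  moreover have "card (M \<inter> red_edges G) = (\<Sum>e\<in>M. of_bool (e \<in> red_edges G))"
    "card (M \<inter> label_edges G L) = (\<Sum>e\<in>M. of_bool (e \<in> label_edges G L))"
    using finM by (simp_all add: of_bool_def sum.If_cases)
  moreover have "card (left G) = (\<Sum>e\<in>M. 1)"
    using bij_betw_same_card[OF bij_betw_matching(1)[OF M]] by simp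
  ultimately have "card {w \<in> verts G. L w = 1} + card (M \<inter> red_edges G) + card (left G)
      + card (M \<inter> label_edges G L) =
    (\<Sum>e\<in>M. L (lend G e) + L (rend G e) + of_bool (e \<in> red_edges G) + 1
      + of_bool (e \<in> label_edges G L))"
    by (simp only: sum.distrib)
  also have "even \<dots>"
  proof (rule dvd_sum)
    fix e assume "e \<in> M"
    then have e: "e \<in> edges G" using ME by auto
    then have "L (lend G e) \<in> {0, 1}" "L (rend G e) \<in> {0, 1}"
      using L ends by (auto simp: verts_def)
    then show "even (L (lend G e) + L (rend G e) + of_bool (e \<in> red_edges G) + 1
      + of_bool (e \<in> label_edges G L))"
      using e by (cases "col G e") (auto simp: red_edges_def label_edges_def)
  qed
  finally show ?thesis .
qed

text \<open>The integer vectors \<open>z\<close> play the part of walks: one whose signed degrees are those of a walk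
  from \<open>a\<close> to \<open>b\<close> witnesses that \<open>a\<close> and \<open>b\<close> are connected, and the label of a vertex is the
  parity of the blue edges on a walk from the root of its component.\<close>

lemma ex_label_avoiding:
  assumes FE: "F \<subseteq> edges G"
    and cyc: "\<And>z :: 'e \<Rightarrow> int. (\<And>e. e \<notin> F \<Longrightarrow> z e = 0) \<Longrightarrow> (\<And>w. w \<in> verts G \<Longrightarrow> wdeg z w = 0)
      \<Longrightarrow> even (sum z (red_edges G))"
  shows "\<exists>L \<in> verts G \<rightarrow>\<^sub>E {0, 1::nat}. F \<inter> label_edges G L = {}"
proof -
  \<comment> \<open>The sign turns degrees into boundaries: an edge counts +1 at its left end and -1
    at its right end, hence is a step from right to left, and its negative is the step back.\<close>
  define sgn where "sgn w = (if w \<in> left G then 1 else - 1 :: int)" for w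
  define walk where "walk a b z \<longleftrightarrow> (\<forall>e. e \<notin> F \<longrightarrow> z e = 0) \<and>
    (\<forall>w\<in>verts G. sgn w * wdeg z w = of_bool (w = b) - of_bool (w = a))" for a b z
  have refl: "walk a a (\<lambda>e. 0)" for a by (simp add: walk_def)
  have trans: "walk a c (\<lambda>e. y e + z e)" if "walk a b y" "walk b c z" for a b c y z
    using that by (auto simp: walk_def sum.distrib distrib_left)
  have sym: "walk b a (\<lambda>e. - z e)" if "walk a b z" for a b z
    using that by (auto simp: walk_def sum_negf)
  have edge: "walk (rend G e) (lend G e) (\<lambda>f. of_bool (f = e))" if "e \<in> F" for e
  proof -
    have e: "e \<in> edges G" using that FE by auto
    have "wdeg (\<lambda>f. of_bool (f = e)) w = (of_bool (e \<in> incident_edges G w) :: int)" for w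
      by (simp add: of_bool_def)
    then show ?thesis
      using that e ends(1,2)[OF e] ends(3) by (auto simp: walk_def sgn_def incident_edges_def)
  qed
  \<comment> \<open>A closed walk has zero degrees. Its total is the sum of the left degrees, so it
    vanishes, and the blue weight is even along with the red one.\<close>
  have closed: "even (sum z (red_edges G))" "sum z (edges G) = 0" if "walk a a z" for a z
  proof -
    have z: "wdeg z w = 0" if "w \<in> verts G" for w
      using \<open>walk a a z\<close> that by (auto simp: walk_def sgn_def split: if_splits)
    show "even (sum z (red_edges G))" using that z by (intro cyc) (auto simp: walk_def)
    have "sum z (edges G) = sum z {e \<in> edges G. lend G e \<in> left G}"
      using ends by (intro sum.cong) auto
    also have "\<dots> = 0" using z by (subst sum_wdeg_left[symmetric]) (auto simp: verts_def)
    finally show "sum z (edges G) = 0" .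
  qed
  \<comment> \<open>The choice depends only on the set of \<open>a\<close> connected to
    \<open>w\<close>, so connected vertices get the same root.\<close>
  define root where "root w = (SOME a. \<exists>z. walk a w z)" for w
  have "\<exists>z. walk (root w) w z" for w
    unfolding root_def by (rule someI[of _ w]) (use refl in blast)
  then obtain p where p: "\<And>w. walk (root w) w (p w)" by metis
  have root_eq: "root (lend G e) = root (rend G e)" if "e \<in> F" for e
  proof -
    have "(\<exists>z. walk a (lend G e) z) \<longleftrightarrow> (\<exists>z. walk a (rend G e) z)" for a
      using trans edge[OF that] sym by blast
    then show ?thesis by (simp add: root_def)
  qed
  define blue where "blue z = sum z (edges G) - sum z (red_edges G)" for z :: "'e \<Rightarrow> int"
  define L where "L = (\<lambda>w\<in>verts G. of_bool (odd (blue (p w))) :: nat)"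
  have "e \<notin> label_edges G L" if "e \<in> F" for e
  proof -
    have e: "e \<in> edges G" using that FE by auto
    let ?u = "lend G e" and ?v = "rend G e"
    have "walk (root ?u) ?u (\<lambda>f. p ?v f + of_bool (f = e))"
      using trans[OF p edge[OF that]] root_eq[OF that] by simp
    then have "walk ?u ?u (\<lambda>f. - p ?u f + (p ?v f + of_bool (f = e)))"
      using trans[OF sym[OF p]] by blast
    from closed[OF this] have "even (blue (\<lambda>f. - p ?u f + (p ?v f + of_bool (f = e))))"
      by (simp add: blue_def)
    \<comment> \<open>The closed walk goes from \<open>?u\<close> back to the root, on to
      \<open>?v\<close> and over \<open>e\<close>. Its even blue weight says that the end labels of
      \<open>e\<close> differ exactly when \<open>e\<close> is blue.\<close>
    moreover have "blue (\<lambda>f. - p ?u f + (p ?v f + of_bool (f = e))) =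
        blue (p ?v) - blue (p ?u) + of_bool (col G e = Blue)"
      using e by (cases "col G e")
        (auto simp: blue_def sum.distrib sum_negf sum_subtractf of_bool_def red_edges_def)
    ultimately have "even (blue (p ?v) - blue (p ?u) + of_bool (col G e = Blue))" by simp
    then show ?thesis
      using e ends(1,2)[OF e] by (cases "col G e") (auto simp: label_edges_def L_def verts_def)
  qed
  moreover have "L \<in> verts G \<rightarrow>\<^sub>E {0, 1}" by (auto simp: L_def)
  ultimately show ?thesis by blast
qed

section \<open>Odd perfect matchings and feasible points\<close>

text \<open>The feasible point is the indicator of \<open>M\<close>, restricted to
  \<open>edges G\<close> because the region consists of extensional functions.\<close>

lemma odd_matching_feasible:
  assumes M: "perfect_matching G M" and odd: "odd (card (M \<inter> red_edges G))"
  shows "(\<lambda>e\<in>edges G. of_bool (e \<in> M)) \<in> feasible_region G (card (left G))"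
  unfolding feasible_region_def
proof (intro CollectI conjI ballI)
  fix w assume "w \<in> verts G"
  then show "wdeg (\<lambda>e\<in>edges G. of_bool (e \<in> M)) w = (1 :: real)"
    by (subst wdeg_matching[OF M, symmetric]) (auto simp: incident_edges_def intro!: sum.cong)
next
  fix L assume "L \<in> all_labelings G (card (left G))"
  then have L: "\<And>w. w \<in> verts G \<Longrightarrow> L w \<in> {0, 1}"
    and "even (card {w \<in> verts G. L w = 1}) = even (card (left G))"
    by (auto simp: all_labelings_def cong_def even_iff_mod_2_eq_zero)
  then have "odd (card (M \<inter> label_edges G L))"
    using label_parity[of M L, OF M L] odd by auto
  then have "1 \<le> real (card (M \<inter> label_edges G L))" by (cases "card (M \<inter> label_edges G L)") auto
  also have "\<dots> = (\<Sum>e\<in>label_edges G L. of_bool (e \<in> M))"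
    by (simp add: of_bool_def sum.If_cases Int_commute)
  also have "\<dots> = (\<Sum>e\<in>label_edges G L. (\<lambda>e\<in>edges G. of_bool (e \<in> M)) e)"
    by (intro sum.cong) (auto simp: label_edges_def)
  finally show "1 \<le> (\<Sum>e\<in>label_edges G L. (\<lambda>e\<in>edges G. of_bool (e \<in> M) :: real) e)" .
qed simp_all

lemma feasible_odd_matching:
  assumes "x \<in> feasible_region G (card (left G))"
  shows "\<exists>M. perfect_matching G M \<and> odd (card (M \<inter> red_edges G))"
proof (rule ccontr)
  assume "\<nexists>M. perfect_matching G M \<and> odd (card (M \<inter> red_edges G))"
  then have even: "\<And>M. perfect_matching G M \<Longrightarrow> even (card (M \<inter> red_edges G))" by blast
  have nonneg: "\<And>e. e \<in> edges G \<Longrightarrow> 0 \<le> x e" and deg: "\<And>w. w \<in> verts G \<Longrightarrow> wdeg x w = 1"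
    and label: "\<And>L. L \<in> all_labelings G (card (left G)) \<Longrightarrow> 1 \<le> sum x (label_edges G L)"
    using assms by (auto simp: feasible_region_def)
  define F where "F = {e \<in> edges G. 0 < x e}"
  have inF: "M \<subseteq> F" if "perfect_matching G M" "\<forall>e\<in>M. 0 < x e" for M
    using that by (auto simp: F_def perfect_matching_def)
  have cover: "\<exists>M. perfect_matching G M \<and> M \<subseteq> F \<and> e \<in> M" if e: "e \<in> F" for e
  proof -
    obtain M where "perfect_matching G M" "\<forall>e\<in>M. 0 < x e" "e \<in> M"
      using perfect_matching_through_edge[of x 1 e] nonneg deg e unfolding F_def by blast
    then show ?thesis using inF by blast
  qed
  have "\<exists>L \<in> verts G \<rightarrow>\<^sub>E {0, 1::nat}. F \<inter> label_edges G L = {}"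
  proof (rule ex_label_avoiding)
    show "F \<subseteq> edges G" by (auto simp: F_def)
    show "even (sum z (red_edges G))"
      if "\<And>e. e \<notin> F \<Longrightarrow> z e = 0" "\<And>w. w \<in> verts G \<Longrightarrow> wdeg z w = 0" for z :: "'e \<Rightarrow> int"
      using cover even that by (rule even_red_sum_circulation)
  qed
  then obtain L where L: "L \<in> verts G \<rightarrow>\<^sub>E {0, 1::nat}" "F \<inter> label_edges G L = {}" by blast
  \<comment> \<open>It remains to see that \<open>L\<close> has the right number of ones modulo 2.
    Any matching in the support shows this by \<open>label_parity\<close>: it is even and misses
    \<open>label_edges G L\<close>.\<close>
  obtain M where M: "perfect_matching G M" "\<forall>e\<in>M. 0 < x e"
    using perfect_matching_in_support[OF nonneg deg] by auto
  then have "M \<inter> label_edges G L = {}" using L(2) inF by blast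
  then have "even (card {w \<in> verts G. L w = 1}) = even (card (left G))"
    using label_parity[OF M(1), of L] L(1) even[OF M(1)] by auto
  then have "L \<in> all_labelings G (card (left G))"
    using L(1) by (simp add: all_labelings_def cong_def mod2_eq_if)
  from label[OF this] have "1 \<le> sum x (label_edges G L)" .
  moreover have "sum x (label_edges G L) = 0"
    using L(2) nonneg by (intro sum.neutral) (force simp: F_def label_edges_def order_le_less)
  ultimately show False by simp
qed

end

theorem theorem5p1:
  fixes G :: "('a, 'e) rb_graph" and n :: nat
  assumes "bipartite_multigraph G"
    and "card (left G) = n" and "card (right G) = n"
  shows "feasible_region G n \<noteq> {} \<longleftrightarrow>
         (\<exists>M. perfect_matching G M \<and> odd (card (M \<inter> red_edges G)))"
proof -
  interpret balanced_graph G using assms by unfold_locales auto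
  show ?thesis
    using odd_matching_feasible feasible_odd_matching assms(2) by blast
qed

end
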